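(* Let $q\in\{4,6\}$. The set $\Gamma_q\mathbf{e}_1$ partitions into the two sets $$C_q=\left\{\begin{pmatrix} a\\ b\lambda_q \end{pmatrix}:\begin{pmatrix} a\\ b \end{pmatrix}\in \mathbb{Z}^2_{prim},\ a\not\equiv 0\bmod \lambda_q^2\right\}\quad\text{and}\quad D_q=\left\{\begin{pmatrix} a\lambda_q\\ b \end{pmatrix}:\begin{pmatrix} a\\ b \end{pmatrix}\in \mathbb{Z}^2_{prim},\ b\not\equiv 0\bmod \lambda_q^2\right\},$$ that is, $\Gamma_q\mathbf{e}_1=C_q\cup D_q$ and $C_q\cap D_q=\emptyset$.
   Context: For an integer $q\geq 3$ let $\lambda_q = 2\cos(\pi/q)$; thus $\lambda_4^2=2$ and $\lambda_6^2=3$ are integers. The Hecke triangle group $\Gamma_q$ is the subgroup of $\mathrm{SL}(2,\mathbb{R})$ generated by $\begin{pmatrix}0 & 1 \\ -1 & 0\end{pmatrix}$ and $\begin{pmatrix}1 & \lambda_q \\ 0 & 1\end{pmatrix}$. Let $\mathbf{e}_1=\begin{pmatrix}1\\0\end{pmatrix}\in\mathbb{R}^2$ and $\Gamma_q\mathbf{e}_1=\{g\mathbf{e}_1: g\in\Gamma_q\}\subset\mathbb{R}^2$. The set of primitive integer vectors is $\mathbb{Z}^2_{prim} = \left\{\begin{pmatrix} a\\ b \end{pmatrix}\in \mathbb{Z}^2: \gcd(a,b) = 1\right\}$ (with $\gcd(a,0)=|a|$). *)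

theory Defs
  imports
    "HOL-Analysis.Analysis"
    "HOL-Algebra.Generated_Groups"
    "HOL-Library.Real_Mod"
    "HOL-Number_Theory.Cong"
begin

definition hecke_lambda :: "nat \<Rightarrow> real" where
  "hecke_lambda q = 2 * cos (pi / real q)"

definition SL2R :: "(real^2^2) monoid" where
  "SL2R = \<lparr>carrier = {A. det A = 1}, mult = (**), one = mat 1\<rparr>"

lemma group_SL2R: "group SL2R"
proof (rule groupI)
  fix A assume "A \<in> carrier SL2R"
  then have dA: "det A = 1" by (simp add: SL2R_def)
  then obtain B where B: "B ** A = mat 1"
    using invertible_det_nz[of A] by (auto simp: invertible_def)
  then have "det B * det A = 1"
    by (metis det_mul det_I)
  with dA B show "\<exists>B\<in>carrier SL2R. B \<otimes>\<^bsub>SL2R\<^esub> A = \<one>\<^bsub>SL2R\<^esub>"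
    by (auto simp: SL2R_def intro!: exI[of _ B])
qed (simp_all add: SL2R_def det_mul matrix_mul_assoc)

definition hecke_group :: "nat \<Rightarrow> (real^2^2) set" where
  "hecke_group q = generate SL2R
     {vector [vector [0, 1], vector [-1, 0]],
      vector [vector [1, hecke_lambda q], vector [0, 1]]}"

lemma hecke_group_subgroup: "subgroup (hecke_group q) SL2R"
  unfolding hecke_group_def
  by (rule group.generate_is_subgroup[OF group_SL2R]) (auto simp: SL2R_def det_2)

definition hecke_orbit :: "nat \<Rightarrow> (real^2) set" where
  "hecke_orbit q = {g *v vector [1, 0] | g. g \<in> hecke_group q}"

definition primitive_vectors :: "(int^2) set" where
  "primitive_vectors = {vector [a, b] | a b. gcd a b = 1}"

(* The modulus is the real number (hecke_lambda q)^2, so the congruence is that of the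
   reals: x = y + k * m for some integer k.  When m is an integer, as it is for q = 4 and
   q = 6 (see below), this is on integers the usual congruence modulo m. *)

definition hecke_C :: "nat \<Rightarrow> (real^2) set" where
  "hecke_C q = {vector [of_int a, of_int b * hecke_lambda q] | a b.
     vector [a, b] \<in> primitive_vectors \<and> \<not> [of_int a = 0] (rmod (hecke_lambda q)\<^sup>2)}"

definition hecke_D :: "nat \<Rightarrow> (real^2) set" where
  "hecke_D q = {vector [of_int a * hecke_lambda q, of_int b] | a b.
     vector [a, b] \<in> primitive_vectors \<and> \<not> [of_int b = 0] (rmod (hecke_lambda q)\<^sup>2)}"

lemma hecke_lambda_4_squared: "(hecke_lambda 4)\<^sup>2 = 2"
  by (simp add: hecke_lambda_def cos_45 power_mult_distrib power_divide)

lemma hecke_lambda_6_squared: "(hecke_lambda 6)\<^sup>2 = 3"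
  by (simp add: hecke_lambda_def cos_30 power_mult_distrib power_divide)

lemma rcong_of_int_iff_cong:
  "[of_int a = of_int b] (rmod of_int m) \<longleftrightarrow> [a = b] (mod m)"
proof -
  have "(of_int b = of_int a + of_int k * (of_int m :: real)) \<longleftrightarrow> b = a + k * m" for k
    by (metis of_int_add of_int_eq_iff of_int_mult)
  then show ?thesis
    by (auto simp: rcong_altdef cong_iff_lin mult.commute)
qed

end

theory Submission
  imports Defs
begin

text \<open>
  Write \<open>\<lambda>\<close> for \<open>hecke_lambda q\<close> and \<open>m = \<lambda>\<^sup>2\<close>; for \<open>q = 4, 6\<close> this is the prime \<open>2\<close> or \<open>3\<close>.
  Because \<open>m\<close> is prime, the two conditions defining \<open>C\<^sub>q\<close> combine into the single coprimality
  \<open>gcd a (m b) = 1\<close>, and those of \<open>D\<^sub>q\<close> into \<open>gcd (m a) b = 1\<close>. In this form it is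
  visible that the generators preserve the union: the rotation \<open>(x, y) \<mapsto> (y, -x)\<close> exchanges
  \<open>C\<^sub>q\<close> and \<open>D\<^sub>q\<close>, while the shear \<open>(x, y) \<mapsto> (x + k \<lambda> y, y)\<close> replaces \<open>a\<close> by
  \<open>a + k m b\<close> on \<open>C\<^sub>q\<close> and by \<open>a + k b\<close> on \<open>D\<^sub>q\<close>. Since \<open>e\<^sub>1\<close> lies in \<open>C\<^sub>q\<close>, so does
  its orbit lie in \<open>C\<^sub>q \<union> D\<^sub>q\<close> (lemma \<open>hecke_orbit_subset\<close>).

  Conversely, a vector of \<open>C\<^sub>q\<close> is brought to \<open>\<plusminus>e\<^sub>1\<close> by a Euclidean algorithm with nearest
  remainders: the upper shears change \<open>a\<close> by multiples of \<open>m b\<close> and the lower shears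
  (conjugates of the upper ones by the rotation) change \<open>b\<close> by multiples of \<open>a\<close>. One round
  leaves \<open>\<bar>a\<bar> \<le> m \<bar>b\<bar> / 2\<close> and then a new second entry of absolute value at most
  \<open>\<bar>a\<bar> / 2 \<le> (m / 4) \<bar>b\<bar>\<close>, so the algorithm terminates because \<open>m < 4\<close>
  (lemma \<open>coprime_vector_in_hecke_orbit\<close>). The vectors of \<open>D\<^sub>q\<close> are rotations of those of \<open>C\<^sub>q\<close>.

  Finally, a common vector of \<open>C\<^sub>q\<close> and \<open>D\<^sub>q\<close> would have first coordinate \<open>a = a' \<lambda>\<close>, so
  that \<open>a\<^sup>2 = m a'\<^sup>2\<close> and the prime \<open>m\<close> would divide \<open>a\<close>.
\<close>

section \<open>The orbit under rotation and shears\<close>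

definition rotation :: "real^2^2" where
  "rotation = vector [vector [0, 1], vector [-1, 0]]"

definition shear :: "real \<Rightarrow> real^2^2" where
  "shear t = vector [vector [1, t], vector [0, 1]]"

lemma rotation_mult_vector: "rotation *v vector [x, y] = vector [y, - x]"
  by (simp add: rotation_def vec_eq_iff forall_2 matrix_vector_mult_def sum_2)

lemma shear_mult_vector: "shear t *v vector [x, y] = vector [x + t * y, y]"
  by (simp add: shear_def vec_eq_iff forall_2 matrix_vector_mult_def sum_2)

lemma shear_mult: "shear s ** shear t = shear (s + t)"
  by (simp add: shear_def vec_eq_iff forall_2 matrix_matrix_mult_def sum_2)

lemma shear_0: "shear 0 = mat 1"
  by (simp add: shear_def vec_eq_iff forall_2 mat_def)

lemma det_rotation: "det rotation = 1"
  by (simp add: rotation_def det_2)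

lemma det_shear: "det (shear t) = 1"
  by (simp add: shear_def det_2)

lemma hecke_group_altdef: "hecke_group q = generate SL2R {rotation, shear (hecke_lambda q)}"
  by (simp add: hecke_group_def rotation_def shear_def)

lemma inv_shear: "inv\<^bsub>SL2R\<^esub> shear t = shear (- t)"
  by (rule group.inv_equality[OF group_SL2R])
     (simp_all add: SL2R_def det_shear shear_mult shear_0)

text \<open>The rotation has order four, so its inverse is its cube.\<close>

lemma inv_rotation: "inv\<^bsub>SL2R\<^esub> rotation = rotation ** rotation ** rotation"
proof (rule group.inv_equality[OF group_SL2R])
  have "rotation ** rotation ** rotation ** rotation = mat 1"
    by (simp add: rotation_def vec_eq_iff forall_2 matrix_matrix_mult_def sum_2 mat_def)
  then show "rotation ** rotation ** rotation \<otimes>\<^bsub>SL2R\<^esub> rotation = \<one>\<^bsub>SL2R\<^esub>"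
    by (simp add: SL2R_def)
qed (simp_all add: SL2R_def det_rotation det_mul)

lemma hecke_group_mult:
  "g \<in> hecke_group q \<Longrightarrow> h \<in> hecke_group q \<Longrightarrow> g ** h \<in> hecke_group q"
  using subgroup.m_closed[OF hecke_group_subgroup] by (simp add: SL2R_def)

lemma shear_in_hecke_group: "shear (of_int k * hecke_lambda q) \<in> hecke_group q"
proof (induction k rule: int_induct[where k = 0])
  case base
  show ?case
    using subgroup.one_closed[OF hecke_group_subgroup, of q] by (simp add: shear_0 SL2R_def)
next
  case (step1 i)
  have "shear (hecke_lambda q) \<in> hecke_group q"
    by (simp add: hecke_group_altdef generate.incl)
  from hecke_group_mult[OF step1.IH this] show ?case
    by (simp add: shear_mult algebra_simps)
next
  case (step2 i)
  have "inv\<^bsub>SL2R\<^esub> shear (hecke_lambda q) \<in> hecke_group q"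
    by (simp add: hecke_group_altdef generate.inv)
  then have "shear (- hecke_lambda q) \<in> hecke_group q"
    by (simp add: inv_shear)
  from hecke_group_mult[OF step2.IH this] show ?case
    by (simp add: shear_mult algebra_simps)
qed

lemma hecke_orbit_mult:
  assumes "g \<in> hecke_group q" "v \<in> hecke_orbit q"
  shows "g *v v \<in> hecke_orbit q"
proof -
  obtain h where "h \<in> hecke_group q" "v = h *v vector [1, 0]"
    using assms(2) by (auto simp: hecke_orbit_def)
  then show ?thesis
    using hecke_group_mult[OF assms(1)]
    by (auto simp: hecke_orbit_def matrix_vector_mul_assoc)
qed

lemma e1_in_hecke_orbit: "vector [1, 0] \<in> hecke_orbit q"
  using shear_in_hecke_group[of 0 q]
  by (auto simp: hecke_orbit_def shear_0 intro!: exI[of _ "mat 1"])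

lemma hecke_orbit_rotate:
  assumes "vector [x, y] \<in> hecke_orbit q"
  shows "vector [y, - x] \<in> hecke_orbit q"
proof -
  have "rotation \<in> hecke_group q"
    by (simp add: hecke_group_altdef generate.incl)
  from hecke_orbit_mult[OF this assms] show ?thesis
    by (simp add: rotation_mult_vector)
qed

lemma hecke_orbit_neg:
  "vector [x, y] \<in> hecke_orbit q \<Longrightarrow> vector [- x, - y] \<in> hecke_orbit q"
  by (intro hecke_orbit_rotate)

lemma hecke_orbit_upper_shear:
  assumes "vector [x, y] \<in> hecke_orbit q"
  shows "vector [x + of_int k * hecke_lambda q * y, y] \<in> hecke_orbit q"
  using hecke_orbit_mult[OF shear_in_hecke_group assms, of k] by (simp add: shear_mult_vector)

text \<open>Conjugating an upper shear by the rotation gives a lower shear.\<close>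

lemma hecke_orbit_lower_shear:
  assumes "vector [x, y] \<in> hecke_orbit q"
  shows "vector [x, y + of_int k * hecke_lambda q * x] \<in> hecke_orbit q"
proof -
  have "vector [y, - x] \<in> hecke_orbit q"
    by (rule hecke_orbit_rotate[OF assms])
  from hecke_orbit_upper_shear[OF this, of "- k"]
  have "vector [y + of_int k * hecke_lambda q * x, - x] \<in> hecke_orbit q"
    by simp
  from hecke_orbit_neg[OF hecke_orbit_rotate[OF this]] show ?thesis
    by (simp add: add.commute)
qed

text \<open>
  Elements of a generated group are words in the generators and their inverses. Stability under
  shears by both signs of \<open>\<lambda>\<close> covers the inverse shear; stability under the rotation covers
  the inverse rotation, which is a power of it.
\<close>

lemma hecke_group_preserves:
  assumes g: "g \<in> hecke_group q"
    and rot: "\<And>v. v \<in> X \<Longrightarrow> rotation *v v \<in> X"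
    and she: "\<And>v. v \<in> X \<Longrightarrow> shear (hecke_lambda q) *v v \<in> X"
    and she': "\<And>v. v \<in> X \<Longrightarrow> shear (- hecke_lambda q) *v v \<in> X"
    and v: "v \<in> X"
  shows "g *v v \<in> X"
  using g[unfolded hecke_group_altdef] v
proof (induction arbitrary: v rule: generate.induct)
  case one
  then show ?case by (simp add: SL2R_def)
next
  case (incl h)
  then show ?case using rot she by auto
next
  case (inv h)
  then show ?case
    using rot she'
    by (auto simp: inv_rotation inv_shear simp flip: matrix_vector_mul_assoc)
next
  case (eng h1 h2)
  then show ?case
    by (simp add: SL2R_def flip: matrix_vector_mul_assoc)
qed

section \<open>The two sets in terms of coprimality\<close>

text \<open>
  A prime that does not divide a number is coprime to it, so the congruence condition is a
  second coprimality condition and the two combine into one.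
\<close>

lemma primitive_not_rcong_iff:
  fixes a b m :: int
  assumes "prime m"
  shows "gcd a b = 1 \<and> \<not> [of_int a = (0 :: real)] (rmod of_int m) \<longleftrightarrow> coprime a (m * b)"
proof -
  have "[of_int a = (0 :: real)] (rmod of_int m) \<longleftrightarrow> m dvd a"
    using rcong_of_int_iff_cong[of a 0 m] by (simp add: cong_0_iff)
  moreover have "\<not> m dvd a \<longleftrightarrow> coprime a m"
    using assms by (metis coprime_commute not_prime_unit prime_imp_coprime coprime_absorb_left)
  ultimately show ?thesis
    by auto
qed

lemma vector_in_primitive_vectors_iff: "vector [a, b] \<in> primitive_vectors \<longleftrightarrow> gcd a b = 1"
  by (auto simp: primitive_vectors_def vec_eq_iff forall_2)

lemma hecke_C_altdef:
  assumes "(hecke_lambda q)\<^sup>2 = of_int m" "prime m"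
  shows "hecke_C q = {vector [of_int a, of_int b * hecke_lambda q] | a b. coprime a (m * b)}"
  unfolding hecke_C_def vector_in_primitive_vectors_iff assms(1)
    primitive_not_rcong_iff[OF assms(2)] ..

lemma hecke_D_altdef:
  assumes "(hecke_lambda q)\<^sup>2 = of_int m" "prime m"
  shows "hecke_D q = {vector [of_int a * hecke_lambda q, of_int b] | a b. coprime (m * a) b}"
proof -
  have "gcd a b = 1 \<and> \<not> [of_int b = (0 :: real)] (rmod of_int m) \<longleftrightarrow> coprime (m * a) b" for a b
    using primitive_not_rcong_iff[OF assms(2), of b a]
    by (simp add: gcd.commute coprime_commute)
  then show ?thesis
    by (simp add: hecke_D_def vector_in_primitive_vectors_iff assms(1))
qed

text \<open>
  Squaring the first coordinate \<open>a = a' \<lambda>\<close> of a common vector gives \<open>m dvd a\<^sup>2\<close>, against the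
  coprimality of \<open>a\<close> and \<open>m\<close>.
\<close>

lemma hecke_C_D_disjoint:
  assumes sq: "(hecke_lambda q)\<^sup>2 = of_int m" and "prime m"
  shows "hecke_C q \<inter> hecke_D q = {}"
proof -
  have False if cop: "coprime a (m * b)" and eq: "of_int a = of_int a' * hecke_lambda q" for a b a'
  proof -
    have "real_of_int (a\<^sup>2) = of_int (a'\<^sup>2 * m)"
      using eq sq by (simp add: power_mult_distrib)
    then have "a\<^sup>2 = a'\<^sup>2 * m"
      by (simp only: of_int_eq_iff)
    then have "m dvd a"
      using \<open>prime m\<close> by (metis dvd_triv_right prime_dvd_power)
    then have "is_unit m"
      using cop by (meson coprime_common_divisor dvd_triv_left)
    then show False
      using \<open>prime m\<close> by (simp add: not_prime_unit)
  qed
  then show ?thesis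
    unfolding hecke_C_altdef[OF assms] hecke_D_altdef[OF assms]
    by (clarsimp simp: vec_eq_iff forall_2 disjoint_iff) metis
qed

lemma hecke_lambda_multiples_mult:
  assumes "(hecke_lambda q)\<^sup>2 = of_int m"
  shows "of_int k * hecke_lambda q * (of_int b * hecke_lambda q) = of_int (k * (m * b))"
proof -
  have "of_int k * hecke_lambda q * (of_int b * hecke_lambda q)
      = of_int k * ((hecke_lambda q)\<^sup>2 * of_int b)"
    by (simp add: power2_eq_square)
  then show ?thesis
    by (simp add: assms)
qed

section \<open>The orbit lies in the union\<close>

lemma rotation_preserves_hecke_C_D:
  assumes sq: "(hecke_lambda q)\<^sup>2 = of_int m" and "prime m"
    and v: "v \<in> hecke_C q \<union> hecke_D q"
  shows "rotation *v v \<in> hecke_C q \<union> hecke_D q"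
  using v
proof
  assume "v \<in> hecke_C q"
  then obtain a b where "v = vector [of_int a, of_int b * hecke_lambda q]" "coprime a (m * b)"
    by (auto simp: hecke_C_altdef[OF assms(1,2)])
  then have "rotation *v v = vector [of_int b * hecke_lambda q, of_int (- a)]"
      "coprime (m * b) (- a)"
    by (simp_all add: rotation_mult_vector coprime_commute)
  then show ?thesis
    unfolding hecke_D_altdef[OF assms(1,2)] by blast
next
  assume "v \<in> hecke_D q"
  then obtain a b where "v = vector [of_int a * hecke_lambda q, of_int b]" "coprime (m * a) b"
    by (auto simp: hecke_D_altdef[OF assms(1,2)])
  then have "rotation *v v = vector [of_int b, of_int (- a) * hecke_lambda q]"
      "coprime b (m * (- a))"
    by (simp_all add: rotation_mult_vector coprime_commute)
  then show ?thesis
    unfolding hecke_C_altdef[OF assms(1,2)] by blast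
qed

lemma shear_preserves_hecke_C_D:
  assumes sq: "(hecke_lambda q)\<^sup>2 = of_int m" and "prime m"
    and v: "v \<in> hecke_C q \<union> hecke_D q"
  shows "shear (of_int k * hecke_lambda q) *v v \<in> hecke_C q \<union> hecke_D q"
  using v
proof
  assume "v \<in> hecke_C q"
  then obtain a b where ab: "v = vector [of_int a, of_int b * hecke_lambda q]" "coprime a (m * b)"
    by (auto simp: hecke_C_altdef[OF assms(1,2)])
  have "shear (of_int k * hecke_lambda q) *v v
      = vector [of_int (k * (m * b) + a), of_int b * hecke_lambda q]"
    unfolding ab(1) shear_mult_vector hecke_lambda_multiples_mult[OF sq]
    by (simp add: add.commute)
  moreover have "coprime (k * (m * b) + a) (m * b)"
    using ab(2) by (metis coprime_iff_gcd_eq_1 gcd.commute gcd_add_mult)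
  ultimately show ?thesis
    unfolding hecke_C_altdef[OF assms(1,2)] by blast
next
  assume "v \<in> hecke_D q"
  then obtain a b where ab: "v = vector [of_int a * hecke_lambda q, of_int b]" "coprime (m * a) b"
    by (auto simp: hecke_D_altdef[OF assms(1,2)])
  have "shear (of_int k * hecke_lambda q) *v v
      = vector [of_int (a + k * b) * hecke_lambda q, of_int b]"
    using ab(1) by (simp add: shear_mult_vector algebra_simps)
  moreover have "coprime (k * m * b + m * a) b"
    using ab(2) by (metis coprime_iff_gcd_eq_1 gcd.commute gcd_add_mult)
  then have "coprime (m * (a + k * b)) b"
    by (simp add: algebra_simps)
  ultimately show ?thesis
    unfolding hecke_D_altdef[OF assms(1,2)] by blast
qed

lemma hecke_orbit_subset:
  assumes "(hecke_lambda q)\<^sup>2 = of_int m" "prime m"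
  shows "hecke_orbit q \<subseteq> hecke_C q \<union> hecke_D q"
proof
  fix v assume "v \<in> hecke_orbit q"
  then obtain g where g: "g \<in> hecke_group q" "v = g *v vector [1, 0]"
    by (auto simp: hecke_orbit_def)
  have "(vector [1, 0] :: real^2) = vector [of_int 1, of_int 0 * hecke_lambda q]" "coprime 1 (m * 0)"
    by simp_all
  then have "(vector [1, 0] :: real^2) \<in> hecke_C q \<union> hecke_D q"
    unfolding hecke_C_altdef[OF assms] by blast
  then show "v \<in> hecke_C q \<union> hecke_D q"
    unfolding g(2)
    using rotation_preserves_hecke_C_D[OF assms] shear_preserves_hecke_C_D[OF assms, of _ 1]
      shear_preserves_hecke_C_D[OF assms, of _ "- 1"]
    by (intro hecke_group_preserves[OF g(1)]) simp_all
qed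

section \<open>The Euclidean algorithm\<close>

lemma nearest_remainder:
  fixes a c :: int
  assumes "c \<noteq> 0"
  obtains k where "2 * \<bar>a + k * c\<bar> \<le> \<bar>c\<bar>"
proof -
  define r where "r = a mod \<bar>c\<bar>"
  have r: "0 \<le> r" "r < \<bar>c\<bar>"
    using assms by (simp_all add: r_def)
  have "r = a + (- sgn c * (a div \<bar>c\<bar>)) * c"
    by (simp add: r_def abs_sgn algebra_simps flip: minus_mult_div_eq_mod)
  then obtain j where j: "r = a + j * c" ..
  show thesis
  proof (cases "2 * r \<le> \<bar>c\<bar>")
    case True
    with r j show thesis by (intro that[of j]) simp
  next
    case False
    \<comment> \<open>A residue in the upper half is replaced by its negative representative.\<close>
    have "a + (j - sgn c) * c = r - \<bar>c\<bar>"
      using j by (simp add: algebra_simps abs_sgn)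
    with False r show thesis by (intro that[of "j - sgn c"]) simp
  qed
qed

text \<open>
  The induction is on \<open>\<bar>b\<bar>\<close>: an upper shear makes the first entry at most \<open>m \<bar>b\<bar> / 2\<close>, and a
  lower shear then makes the second at most half of that. The second division is possible because
  the first entry, being coprime to a multiple of \<open>m \<ge> 2\<close>, is not zero.
\<close>

lemma coprime_vector_in_hecke_orbit:
  assumes sq: "(hecke_lambda q)\<^sup>2 = of_int m" and m: "2 \<le> m" "m < 4"
  shows "coprime a (m * b) \<Longrightarrow> vector [of_int a, of_int b * hecke_lambda q] \<in> hecke_orbit q"
proof (induction "nat \<bar>b\<bar>" arbitrary: a b rule: less_induct)
  case less
  show ?case
  proof (cases "b = 0")
    case True
    with less.prems have "a = 1 \<or> a = - 1"
      by auto
    then show ?thesis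
      using True e1_in_hecke_orbit[of q] hecke_orbit_neg[OF e1_in_hecke_orbit[of q]] by auto
  next
    case False
    obtain k where k: "2 * \<bar>a + k * (m * b)\<bar> \<le> \<bar>m * b\<bar>"
      using nearest_remainder[of "m * b" a] False m by auto
    define a' where "a' = a + k * (m * b)"
    have cop: "coprime a' (m * b)"
      using less.prems by (metis a'_def add.commute coprime_iff_gcd_eq_1 gcd.commute gcd_add_mult)
    have "a' \<noteq> 0"
    proof
      assume "a' = 0"
      with cop have "is_unit m" by auto
      with m show False by simp
    qed
    obtain l where l: "2 * \<bar>b + l * a'\<bar> \<le> \<bar>a'\<bar>"
      using nearest_remainder[OF \<open>a' \<noteq> 0\<close>] .
    define b' where "b' = b + l * a'"
    have "coprime a' m" "coprime a' b"
      using cop by simp_all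
    moreover have "coprime a' b'"
      using \<open>coprime a' b\<close>
      by (metis b'_def add.commute coprime_iff_gcd_eq_1 gcd_add_mult)
    ultimately have cop': "coprime a' (m * b')"
      by simp
    have "4 * \<bar>b'\<bar> \<le> m * \<bar>b\<bar>"
      using k l m by (simp add: a'_def b'_def abs_mult)
    also have "\<dots> < 4 * \<bar>b\<bar>"
      using m False by simp
    finally have "nat \<bar>b'\<bar> < nat \<bar>b\<bar>"
      by simp
    from less.hyps[OF this cop']
    have "vector [of_int a', of_int b' * hecke_lambda q] \<in> hecke_orbit q" .
    \<comment> \<open>The two shears are undone in the opposite order.\<close>
    from hecke_orbit_lower_shear[OF this, of "- l"]
    have "vector [of_int a', of_int b * hecke_lambda q] \<in> hecke_orbit q"
      by (simp add: b'_def algebra_simps)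
    from hecke_orbit_upper_shear[OF this, of "- k"] show ?thesis
      unfolding hecke_lambda_multiples_mult[OF sq] by (simp add: a'_def)
  qed
qed

lemma hecke_C_D_subset_orbit:
  assumes "(hecke_lambda q)\<^sup>2 = of_int m" "prime m" "m < 4"
  shows "hecke_C q \<union> hecke_D q \<subseteq> hecke_orbit q"
proof -
  note orbit = coprime_vector_in_hecke_orbit[OF assms(1) prime_ge_2_int[OF assms(2)] assms(3)]
  have "vector [of_int a * hecke_lambda q, of_int b] \<in> hecke_orbit q" if "coprime (m * a) b" for a b
  proof -
    have "coprime (- b) (m * a)"
      using that by (simp add: coprime_commute)
    from hecke_orbit_rotate[OF orbit[OF this]] show ?thesis
      by simp
  qed
  with orbit show ?thesis
    by (auto simp: hecke_C_altdef[OF assms(1,2)] hecke_D_altdef[OF assms(1,2)])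
qed

theorem proposition2:
  fixes q :: nat
  assumes "q \<in> {4, 6}"
  shows "hecke_orbit q = hecke_C q \<union> hecke_D q \<and> hecke_C q \<inter> hecke_D q = {}"
proof -
  obtain m :: int where m: "(hecke_lambda q)\<^sup>2 = of_int m" "prime m" "m < 4"
  proof (cases "q = 4")
    case True
    then show ?thesis
      using that[of 2] by (simp add: hecke_lambda_4_squared)
  next
    case False
    have "prime (3 :: int)"
      by (simp add: prime_int_numeral_eq)
    with False assms show ?thesis
      using that[of 3] by (simp add: hecke_lambda_6_squared)
  qed
  show ?thesis
    using hecke_orbit_subset[OF m(1,2)] hecke_C_D_subset_orbit[OF m] hecke_C_D_disjoint[OF m(1,2)]
    by blast
qed

end
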